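(* Let $0<\beta<1$, $B=0$, and let $(A_N)$ be a sequence of coupling matrices such that $\lim_{N\to\infty}\max_{1\le i\le N}R_i=1$. Let $\boldsymbol\sigma$ be drawn from the Ising model $\mathbb P$ with parameters $(A_N,\beta,0)$, and set $\alpha_N=\max_{1\le i\le N}\sum_{j=1}^NA_N(i,j)^2$. Then the following conclusions hold: (a) $$\log\mathbb P\Big(\max_{1\le i\le N}|m_i(\boldsymbol\sigma)|\ge\lambda\sqrt{\alpha_N\log N}\Big)\lesssim-\lambda^2,\quad\text{for any }\lambda>0.$$ (b) $$\mathbb E\left[\sum_{i=1}^N(R_i-1)\sigma_i\right]^2\lesssim\left(\sum_{i=1}^N(R_i-1)^2\right)\Big[1+\lVert A_N\rVert_F^2\,\alpha_N^2(\log N)^2\Big].$$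
   Context: A coupling matrix $A_N$ is a symmetric $N\times N$ matrix with non-negative entries and zeros on the diagonal. The Ising model with parameters $(A_N,\beta,B)$, $\beta>0$, $B\in\mathbb R$, is the probability mass function on $\boldsymbol\sigma=(\sigma_1,\dots,\sigma_N)\in\{-1,1\}^N$ given by $\mathbb P(\boldsymbol\sigma)=\frac1{Z_N(\beta,B)}\exp\big(\frac\beta2\boldsymbol\sigma^\top A_N\boldsymbol\sigma+B\sum_{i=1}^N\sigma_i\big)$, where $Z_N(\beta,B)$ is the normalizing constant; $\mathbb E$ is expectation under it. Put $m_i(\boldsymbol\sigma)=\sum_{j=1}^NA_N(i,j)\sigma_j$, $R_i=\sum_{j=1}^NA_N(i,j)$, and let $\lVert\cdot\rVert_F$ be the Frobenius norm. $\mathbb E[X]^2$ denotes the second moment $\mathbb E[X^2]$. $x_N\lesssim y_N$ means there is a finite constant $C>0$ free of $N$ with $x_N\le Cy_N$; in particular $\log\mathbb P(\cdot)\lesssim-\lambda^2$ means $\log\mathbb P(\cdot)\le-C\lambda^2$ for such a constant $C>0$.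
   Formalization: Part (a) fails for small λ (λ=1, disjoint complete graphs on about log N sites) and for small N (A_N may be 0); it is stated for all λ ≥ λ0, with some λ0 > 0 free of N, and all sufficiently large N, with C free of N and λ. *)

theory Defs
  imports "HOL-Probability.Probability"
begin

text \<open>
  The dimension \<open>N\<close> varies along the sequence of models, so an \<open>N \<times> N\<close> matrix is a function
  \<open>nat \<Rightarrow> nat \<Rightarrow> real\<close> of which only the entries with indices below \<open>N\<close> are used; the sites
  \<open>1, \<dots>, N\<close> are numbered \<open>0, \<dots>, N - 1\<close>.
\<close>

definition coupling_matrix :: "nat \<Rightarrow> (nat \<Rightarrow> nat \<Rightarrow> real) \<Rightarrow> bool" where
  "coupling_matrix N A \<longleftrightarrow>
     (\<forall>i<N. \<forall>j<N. A i j = A j i) \<and> (\<forall>i<N. \<forall>j<N. 0 \<le> A i j) \<and> (\<forall>i<N. A i i = 0)"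

definition spin_configs :: "nat \<Rightarrow> (nat \<Rightarrow> real) set" where
  "spin_configs N = ({..<N} \<rightarrow>\<^sub>E {-1, 1})"

definition ising_weight ::
  "nat \<Rightarrow> (nat \<Rightarrow> nat \<Rightarrow> real) \<Rightarrow> real \<Rightarrow> real \<Rightarrow> (nat \<Rightarrow> real) \<Rightarrow> real" where
  "ising_weight N A \<beta> B \<sigma> =
     exp (\<beta> / 2 * (\<Sum>i<N. \<Sum>j<N. \<sigma> i * A i j * \<sigma> j) + B * (\<Sum>i<N. \<sigma> i))"

definition partition_function :: "nat \<Rightarrow> (nat \<Rightarrow> nat \<Rightarrow> real) \<Rightarrow> real \<Rightarrow> real \<Rightarrow> real" where
  "partition_function N A \<beta> B = (\<Sum>\<sigma>\<in>spin_configs N. ising_weight N A \<beta> B \<sigma>)"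

definition ising :: "nat \<Rightarrow> (nat \<Rightarrow> nat \<Rightarrow> real) \<Rightarrow> real \<Rightarrow> real \<Rightarrow> (nat \<Rightarrow> real) pmf" where
  "ising N A \<beta> B =
     embed_pmf (\<lambda>\<sigma>. if \<sigma> \<in> spin_configs N
       then ising_weight N A \<beta> B \<sigma> / partition_function N A \<beta> B else 0)"

lemma finite_spin_configs: "finite (spin_configs N)"
  unfolding spin_configs_def by (rule finite_PiE) auto

lemma partition_function_pos: "0 < partition_function N A \<beta> B"
  unfolding partition_function_def
proof (rule sum_pos[OF finite_spin_configs])
  show "spin_configs N \<noteq> {}"
    by (simp add: spin_configs_def PiE_eq_empty_iff)
qed (simp add: ising_weight_def)

text \<open>The side conditions of \<^const>\<open>embed_pmf\<close> hold, so \<open>ising\<close> has the intended mass function.\<close>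

lemma pmf_ising:
  "pmf (ising N A \<beta> B) \<sigma> =
     (if \<sigma> \<in> spin_configs N then ising_weight N A \<beta> B \<sigma> / partition_function N A \<beta> B else 0)"
  unfolding ising_def
proof (rule pmf_embed_pmf)
  let ?Z = "partition_function N A \<beta> B"
  let ?f = "\<lambda>\<sigma>. if \<sigma> \<in> spin_configs N then ising_weight N A \<beta> B \<sigma> / ?Z else 0"
  show nn: "0 \<le> ?f \<tau>" for \<tau>
    using partition_function_pos[of N A \<beta> B] by (simp add: ising_weight_def)
  have "(\<integral>\<^sup>+ \<tau>. ennreal (?f \<tau>) \<partial>count_space UNIV) = (\<Sum>\<tau>\<in>spin_configs N. ennreal (?f \<tau>))"
    by (rule nn_integral_count_space'[OF finite_spin_configs]) (auto split: if_splits)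
  also have "\<dots> = ennreal (\<Sum>\<tau>\<in>spin_configs N. ?f \<tau>)"
    using nn by (rule sum_ennreal)
  also have "(\<Sum>\<tau>\<in>spin_configs N. ?f \<tau>) = (\<Sum>\<tau>\<in>spin_configs N. ising_weight N A \<beta> B \<tau>) / ?Z"
    by (simp add: sum_divide_distrib)
  also have "\<dots> = 1"
    using partition_function_pos[of N A \<beta> B] by (simp add: partition_function_def)
  finally show "(\<integral>\<^sup>+ \<tau>. ennreal (?f \<tau>) \<partial>count_space UNIV) = 1"
    by simp
qed

definition local_field :: "nat \<Rightarrow> (nat \<Rightarrow> nat \<Rightarrow> real) \<Rightarrow> nat \<Rightarrow> (nat \<Rightarrow> real) \<Rightarrow> real" where
  "local_field N A i \<sigma> = (\<Sum>j<N. A i j * \<sigma> j)"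

definition row_sum :: "nat \<Rightarrow> (nat \<Rightarrow> nat \<Rightarrow> real) \<Rightarrow> nat \<Rightarrow> real" where
  "row_sum N A i = (\<Sum>j<N. A i j)"

definition alpha :: "nat \<Rightarrow> (nat \<Rightarrow> nat \<Rightarrow> real) \<Rightarrow> real" where
  "alpha N A = (MAX i\<in>{..<N}. \<Sum>j<N. (A i j)\<^sup>2)"

definition frobenius_norm :: "nat \<Rightarrow> (nat \<Rightarrow> nat \<Rightarrow> real) \<Rightarrow> real" where
  "frobenius_norm N A = sqrt (\<Sum>i<N. \<Sum>j<N. (A i j)\<^sup>2)"

text \<open>
  Logarithm of a probability, with \<open>log 0 = -\<infinity>\<close>; the library's \<^const>\<open>ln\<close> has \<open>ln 0 = 0\<close>, which
  would make an upper bound on \<open>log P\<close> fail for null events.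
\<close>

definition log_prob :: "real \<Rightarrow> ereal" where
  "log_prob p = (if p = 0 then -\<infinity> else ereal (ln p))"

end

theory Submission
  imports Defs
begin

text \<open>
  Write \<open>\<langle>_\<rangle>\<close> for the Gibbs average with interaction \<open>J = \<beta> A\<close> and a field \<open>h \<ge> 0\<close>. Summing out \<open>\<sigma>\<^sub>k\<close> turns
  \<open>\<langle>x\<^sub>k - \<sigma>\<^sub>k\<rangle>\<close>, where \<open>x\<^sub>k = (\<Sum>j. J k j * \<sigma>\<^sub>j) + h\<^sub>k\<close>, into an average of \<open>x cosh x - sinh x\<close>, whose Taylor
  coefficients are nonnegative; by Griffiths' first inequality it is nonnegative. So the
  magnetizations satisfy the linear mean-field bound \<open>m \<le> J m + h\<close>, and as the row sums of \<open>J\<close> are at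
  most \<open>1 - \<delta>\<close>, this gives \<open>\<langle>h, m\<rangle> \<le> |h|\<^sup>2 / \<delta>\<close>. Integrating along \<open>t * h\<close> yields the sub-Gaussian bound
  \<open>exp (|h|\<^sup>2 / (2 \<delta>))\<close> for the moment generating function at zero field. Part (a) follows by Chernoff
  and a union bound. For (b), the pair correlations are nonnegative, so the coefficients \<open>R\<^sub>i - 1\<close> may be
  replaced by their absolute values, and the moment generating function bounds the second moment.
\<close>

section \<open>Griffiths' first inequality by a class of positive multipliers\<close>

text \<open>
  Arbitrary exponents \<open>p\<close>, rather than subsets of the sites, make the condition visibly stable under
  multiplication by a spin.
\<close>

definition pos_weight :: "nat \<Rightarrow> ((nat \<Rightarrow> real) \<Rightarrow> real) \<Rightarrow> bool" where
  "pos_weight N w \<longleftrightarrow> (\<forall>p. 0 \<le> (\<Sum>\<sigma>\<in>spin_configs N. w \<sigma> * (\<Prod>i<N. \<sigma> i ^ p i)))"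

text \<open>Multipliers, unlike weights, compose under products at once, so positivity of a compound
  function is built up by closure rules.\<close>

definition pos_mult :: "nat \<Rightarrow> ((nat \<Rightarrow> real) \<Rightarrow> real) \<Rightarrow> bool" where
  "pos_mult N g \<longleftrightarrow> (\<forall>w. pos_weight N w \<longrightarrow> pos_weight N (\<lambda>\<sigma>. w \<sigma> * g \<sigma>))"

text \<open>The sum factorizes over the sites, and each factor \<open>(-1) ^ p i + 1\<close> is 0 or
  2.\<close>

lemma pos_weight_1: "pos_weight N (\<lambda>\<sigma>. 1)"
  unfolding pos_weight_def
proof
  fix p :: "nat \<Rightarrow> nat"
  have "(\<Sum>\<sigma>\<in>spin_configs N. \<Prod>i<N. \<sigma> i ^ p i) = (\<Prod>i<N. \<Sum>s\<in>{-1, 1::real}. s ^ p i)"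
    unfolding spin_configs_def by (rule prod_sum_PiE[symmetric]) auto
  also have "\<dots> \<ge> 0"
    by (rule prod_nonneg) (simp add: uminus_power_if)
  finally show "0 \<le> (\<Sum>\<sigma>\<in>spin_configs N. 1 * (\<Prod>i<N. \<sigma> i ^ p i))" by simp
qed

text \<open>Griffiths' first inequality in abstract form: apply the multiplier to the weight 1 and
  take all exponents 0.\<close>

lemma pos_mult_sum_nonneg:
  assumes "pos_mult N g" shows "0 \<le> (\<Sum>\<sigma>\<in>spin_configs N. g \<sigma>)"
proof -
  have "pos_weight N g"
    using assms pos_weight_1 unfolding pos_mult_def by fastforce
  then show ?thesis
    unfolding pos_weight_def by (elim allE[of _ "\<lambda>_. 0"]) simp
qed

lemma pos_mult_const: "0 \<le> c \<Longrightarrow> pos_mult N (\<lambda>\<sigma>. c)"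
  unfolding pos_mult_def pos_weight_def
  by (simp add: mult.assoc mult.left_commute[of _ c] flip: sum_distrib_left)

lemma pos_mult_spin:
  assumes "k < N" shows "pos_mult N (\<lambda>\<sigma>. \<sigma> k)"
  unfolding pos_mult_def pos_weight_def
proof (intro allI impI)
  fix w :: "(nat \<Rightarrow> real) \<Rightarrow> real" and p :: "nat \<Rightarrow> nat"
  assume w: "\<forall>p. 0 \<le> (\<Sum>\<sigma>\<in>spin_configs N. w \<sigma> * (\<Prod>i<N. \<sigma> i ^ p i))"
  \<comment> \<open>Multiplying by the spin at \<open>k\<close> only raises the exponent
    \<open>p k\<close> by one.\<close>
  have "(\<Prod>i<N. \<sigma> i ^ (p(k := Suc (p k))) i) = \<sigma> k * (\<Prod>i<N. \<sigma> i ^ p i)" for \<sigma> :: "nat \<Rightarrow> real"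
    using assms by (simp add: prod.remove[of _ k] mult.assoc)
  then show "0 \<le> (\<Sum>\<sigma>\<in>spin_configs N. w \<sigma> * \<sigma> k * (\<Prod>i<N. \<sigma> i ^ p i))"
    using w[rule_format, of "p(k := Suc (p k))"] by (simp add: mult.assoc)
qed

lemma pos_mult_add:
  assumes "pos_mult N f" "pos_mult N g" shows "pos_mult N (\<lambda>\<sigma>. f \<sigma> + g \<sigma>)"
  using assms unfolding pos_mult_def pos_weight_def
  by (simp add: distrib_left distrib_right sum.distrib)

lemma pos_mult_mult:
  assumes "pos_mult N f" "pos_mult N g" shows "pos_mult N (\<lambda>\<sigma>. f \<sigma> * g \<sigma>)"
  using assms unfolding pos_mult_def by (simp flip: mult.assoc)

lemma pos_mult_sum:
  assumes "\<And>i. i \<in> I \<Longrightarrow> pos_mult N (f i)" shows "pos_mult N (\<lambda>\<sigma>. \<Sum>i\<in>I. f i \<sigma>)"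
  using assms by (induction I rule: infinite_finite_induct)
    (simp_all add: pos_mult_const pos_mult_add)

lemma pos_mult_power:
  assumes "pos_mult N f" shows "pos_mult N (\<lambda>\<sigma>. f \<sigma> ^ n)"
  using assms by (induction n) (simp_all add: pos_mult_const pos_mult_mult)

text \<open>The configuration sum is finite, so it commutes with the series, and nonnegativity
  passes from the terms to the limit.\<close>

lemma pos_mult_sums:
  assumes "\<And>n. pos_mult N (f n)" and sums: "\<And>\<sigma>. (\<lambda>n. f n \<sigma>) sums g \<sigma>"
  shows "pos_mult N g"
  unfolding pos_mult_def
proof (intro allI impI)
  fix w assume w: "pos_weight N w"
  show "pos_weight N (\<lambda>\<sigma>. w \<sigma> * g \<sigma>)"
    unfolding pos_weight_def
  proof
    fix p :: "nat \<Rightarrow> nat"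
    have lim: "(\<lambda>n. \<Sum>\<sigma>\<in>spin_configs N. w \<sigma> * f n \<sigma> * (\<Prod>i<N. \<sigma> i ^ p i)) sums
        (\<Sum>\<sigma>\<in>spin_configs N. w \<sigma> * g \<sigma> * (\<Prod>i<N. \<sigma> i ^ p i))"
      by (intro sums_sum sums_mult sums_mult2 sums)
    have "0 \<le> (\<Sum>\<sigma>\<in>spin_configs N. w \<sigma> * f n \<sigma> * (\<Prod>i<N. \<sigma> i ^ p i))" for n
      using assms(1)[of n] w unfolding pos_mult_def pos_weight_def by blast
    then show "0 \<le> (\<Sum>\<sigma>\<in>spin_configs N. w \<sigma> * g \<sigma> * (\<Prod>i<N. \<sigma> i ^ p i))"
      by (rule sums_le[OF _ sums_zero lim])
  qed
qed

lemma pos_mult_exp: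
  assumes "pos_mult N f" shows "pos_mult N (\<lambda>\<sigma>. exp (f \<sigma>))"
proof (rule pos_mult_sums)
  show "(\<lambda>n. inverse (fact n) * f \<sigma> ^ n) sums exp (f \<sigma>)" for \<sigma>
    using exp_converges[of "f \<sigma>"] by simp
qed (intro pos_mult_mult pos_mult_const pos_mult_power assms, simp)

text \<open>All Taylor coefficients of \<open>x cosh x - sinh x\<close> are nonnegative.\<close>

lemma pos_mult_cosh_sinh:
  assumes "pos_mult N f"
  shows "pos_mult N (\<lambda>\<sigma>. f \<sigma> * cosh (f \<sigma>) - sinh (f \<sigma>))"
proof (rule pos_mult_sums)
  \<comment> \<open>For odd n, 1/(n-1)! from x cosh x minus 1/n! from sinh x is (n-1)/n!. The
    truncated case n = 0 falls under the even branch.\<close>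
  define c :: "nat \<Rightarrow> real" where
    "c n = (if even n then 0 else real (n - 1) / fact n)" for n
  have c_nonneg: "0 \<le> c n" for n by (simp add: c_def)
  show "pos_mult N (\<lambda>\<sigma>. c n * f \<sigma> ^ n)" for n
    by (intro pos_mult_mult pos_mult_const pos_mult_power assms c_nonneg)
  show "(\<lambda>n. c n * f \<sigma> ^ n) sums (f \<sigma> * cosh (f \<sigma>) - sinh (f \<sigma>))" for \<sigma>
  proof -
    define x where "x = f \<sigma>"
    let ?C = "\<lambda>n. if even n then x ^ n /\<^sub>R fact n else 0"
    let ?S = "\<lambda>n. if even n then 0 else x ^ n /\<^sub>R fact n"
    have "(\<lambda>n. x * ?C n) sums (x * cosh x)"
      by (intro sums_mult cosh_converges)
    \<comment> \<open>Multiplication by \<open>x\<close> raises degrees, so the series is shifted by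
      one to match powers with that of sinh.\<close>
    then have "(\<lambda>n. case n of 0 \<Rightarrow> 0 | Suc m \<Rightarrow> x * ?C m) sums (x * cosh x)"
      using sums_Suc_iff[of "\<lambda>n. case n of 0 \<Rightarrow> 0 | Suc m \<Rightarrow> x * ?C m"] by simp
    then have "(\<lambda>n. (case n of 0 \<Rightarrow> 0 | Suc m \<Rightarrow> x * ?C m) - ?S n) sums (x * cosh x - sinh x)"
      by (intro sums_diff sinh_converges)
    moreover have "(case n of 0 \<Rightarrow> 0 | Suc m \<Rightarrow> x * ?C m) - ?S n = c n * x ^ n" for n
      proof (cases n)
      case (Suc m)
      have "fact n = (1 + real m) * fact m" by (simp add: Suc)
      moreover have "1 + real m \<noteq> 0" by linarith
      ultimately have "inverse (fact m) = (1 + real m) / fact n"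
        by (simp add: divide_inverse)
      then show ?thesis by (simp add: Suc c_def divide_inverse algebra_simps del: fact_Suc)
    qed (simp add: c_def)
    ultimately show ?thesis by (simp add: x_def)
  qed
qed

section \<open>Gibbs weights and the mean-field bound on magnetizations\<close>

text \<open>Unnormalized, with the inverse temperature absorbed into \<open>J\<close>. The field
  varies from site to site so that it can serve as the argument of a generating function.\<close>

definition gibbs :: "nat \<Rightarrow> (nat \<Rightarrow> nat \<Rightarrow> real) \<Rightarrow> (nat \<Rightarrow> real) \<Rightarrow> (nat \<Rightarrow> real) \<Rightarrow> real" where
  "gibbs N J h \<sigma> = exp ((\<Sum>i<N. \<Sum>j<N. \<sigma> i * J i j * \<sigma> j) / 2 + (\<Sum>i<N. h i * \<sigma> i))"

lemma pos_mult_gibbs: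
  assumes "coupling_matrix N J" and "\<And>i. i < N \<Longrightarrow> 0 \<le> h i"
  shows "pos_mult N (gibbs N J h)"
  unfolding gibbs_def[abs_def] divide_inverse using assms
  by (intro pos_mult_exp pos_mult_add pos_mult_mult pos_mult_sum pos_mult_spin pos_mult_const)
     (auto simp: coupling_matrix_def)

lemma spin_square:
  assumes "\<sigma> \<in> spin_configs N" "k < N" shows "\<sigma> k = 1 \<or> \<sigma> k = -1"
  using assms by (auto simp: spin_configs_def PiE_iff)

lemma sum_flip:
  assumes "k < N"
  shows "(\<Sum>\<sigma>\<in>spin_configs N. f (\<sigma>(k := - \<sigma> k))) = (\<Sum>\<sigma>\<in>spin_configs N. (f \<sigma> :: real))"
  using assms
  by (intro sum.reindex_bij_witness[where i = "\<lambda>\<sigma>. \<sigma>(k := - \<sigma> k)" and j = "\<lambda>\<sigma>. \<sigma>(k := - \<sigma> k)"])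
     (auto simp: spin_configs_def PiE_iff extensional_def)

text \<open>Pairing each configuration with its flip at \<open>k\<close> isolates the factor x cosh
  x - sinh x; the remaining factor is the exponential of a polynomial in the spins with nonnegative
  coefficients.\<close>

lemma mean_spin_le:
  assumes J: "coupling_matrix N J" and h: "\<And>i. i < N \<Longrightarrow> 0 \<le> h i" and k: "k < N"
  shows "(\<Sum>\<sigma>\<in>spin_configs N. gibbs N J h \<sigma> * \<sigma> k) \<le>
    (\<Sum>\<sigma>\<in>spin_configs N. gibbs N J h \<sigma> * ((\<Sum>j<N. J k j * \<sigma> j) + h k))"
proof -
  \<comment> \<open>The exponent splits as \<open>r \<sigma> + \<sigma> k * x \<sigma>\<close>,
    where neither \<open>r\<close> nor \<open>x\<close> involves the spin at \<open>k\<close>. By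
    symmetry of \<open>J\<close>, row and column \<open>k\<close> contribute equally, cancelling the
    factor 1/2.\<close>
  define x where "x \<sigma> = (\<Sum>j\<in>{..<N}-{k}. J k j * \<sigma> j) + h k" for \<sigma> :: "nat \<Rightarrow> real"
  define r where "r \<sigma> = (\<Sum>i\<in>{..<N}-{k}. \<Sum>j\<in>{..<N}-{k}. \<sigma> i * J i j * \<sigma> j) * (1/2)
    + (\<Sum>i\<in>{..<N}-{k}. h i * \<sigma> i)" for \<sigma> :: "nat \<Rightarrow> real"
  have Jkk: "J k k = 0" using J k by (simp add: coupling_matrix_def)
  have x_eq: "(\<Sum>j<N. J k j * \<sigma> j) + h k = x \<sigma>" for \<sigma>
    using k Jkk by (simp add: x_def sum.remove[of _ k])
  have sym: "(\<Sum>i\<in>{..<N}-{k}. \<sigma> i * J i k * \<sigma> k) = \<sigma> k * (\<Sum>j\<in>{..<N}-{k}. J k j * \<sigma> j)" for \<sigma>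
    using J k unfolding sum_distrib_left
    by (intro sum.cong) (auto simp: coupling_matrix_def)
  have g_eq: "gibbs N J h \<sigma> = exp (r \<sigma>) * exp (\<sigma> k * x \<sigma>)" for \<sigma>
    using k Jkk unfolding gibbs_def x_def r_def exp_add[symmetric] exp_inj_iff
    by (simp add: sum.remove[of "{..<N}" k] sum.distrib sym)
       (simp add: sum_distrib_left algebra_simps)
  have flip: "x (\<sigma>(k := s)) = x \<sigma>" "r (\<sigma>(k := s)) = r \<sigma>" for \<sigma> s
    by (auto simp: x_def r_def intro!: arg_cong2[of _ _ _ _ "(+)"] sum.cong)
  let ?F = "\<lambda>\<sigma>. gibbs N J h \<sigma> * (x \<sigma> - \<sigma> k)"
  have "?F \<sigma> + ?F (\<sigma>(k := - \<sigma> k)) = 2 * (exp (r \<sigma>) * (x \<sigma> * cosh (x \<sigma>) - sinh (x \<sigma>)))"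
    if "\<sigma> \<in> spin_configs N" for \<sigma>
    using spin_square[OF that k] unfolding g_eq flip
    by (auto simp: cosh_def sinh_def algebra_simps)
  then have "(\<Sum>\<sigma>\<in>spin_configs N. ?F \<sigma> + ?F (\<sigma>(k := - \<sigma> k))) =
      2 * (\<Sum>\<sigma>\<in>spin_configs N. exp (r \<sigma>) * (x \<sigma> * cosh (x \<sigma>) - sinh (x \<sigma>)))"
    unfolding sum_distrib_left by (intro sum.cong refl)
  \<comment> \<open>The flip permutes the configurations, so the paired sum counts \<open>?F\<close>
    twice.\<close>
  then have "2 * (\<Sum>\<sigma>\<in>spin_configs N. ?F \<sigma>) =
      2 * (\<Sum>\<sigma>\<in>spin_configs N. exp (r \<sigma>) * (x \<sigma> * cosh (x \<sigma>) - sinh (x \<sigma>)))"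
    unfolding sum.distrib sum_flip[OF k, of ?F] mult_2 .
  moreover have "pos_mult N (\<lambda>\<sigma>. exp (r \<sigma>) * (x \<sigma> * cosh (x \<sigma>) - sinh (x \<sigma>)))"
    unfolding r_def x_def using J h k
    by (intro pos_mult_mult pos_mult_exp pos_mult_cosh_sinh pos_mult_add pos_mult_sum
          pos_mult_spin pos_mult_const) (auto simp: coupling_matrix_def)
  then have "0 \<le> (\<Sum>\<sigma>\<in>spin_configs N. exp (r \<sigma>) * (x \<sigma> * cosh (x \<sigma>) - sinh (x \<sigma>)))"
    by (rule pos_mult_sum_nonneg)
  ultimately have "0 \<le> (\<Sum>\<sigma>\<in>spin_configs N. ?F \<sigma>)"
    by linarith
  then show ?thesis
    unfolding x_eq by (simp add: right_diff_distrib sum_subtractf)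
qed


section \<open>From the mean-field bound to a sub-Gaussian generating function\<close>

text \<open>Pairing the inequality with \<open>m\<close> and bounding the quadratic form of
  \<open>J\<close> by its row sums (Schur test) gives \<delta> |m|^2 \<le> <h, m>; Young's
  inequality then eliminates |m|^2.\<close>

lemma linear_bound_from_mean_field:
  fixes m h :: "nat \<Rightarrow> real"
  assumes J: "coupling_matrix N J" and \<delta>: "0 < \<delta>"
    and row: "\<And>i. i < N \<Longrightarrow> row_sum N J i \<le> 1 - \<delta>"
    and m: "\<And>i. i < N \<Longrightarrow> 0 \<le> m i" "\<And>i. i < N \<Longrightarrow> m i \<le> (\<Sum>j<N. J i j * m j) + h i"
  shows "(\<Sum>i<N. h i * m i) \<le> (\<Sum>i<N. (h i)\<^sup>2) / \<delta>"
proof -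
  let ?M = "\<Sum>i<N. (m i)\<^sup>2"
  have "?M \<le> (\<Sum>i<N. m i * ((\<Sum>j<N. J i j * m j) + h i))"
    unfolding power2_eq_square using m by (intro sum_mono mult_left_mono) auto
  also have "\<dots> = (\<Sum>i<N. \<Sum>j<N. J i j * (m i * m j)) + (\<Sum>i<N. h i * m i)"
    by (simp add: distrib_left sum.distrib sum_distrib_left mult_ac)
  also have "(\<Sum>i<N. \<Sum>j<N. J i j * (m i * m j)) \<le>
      (\<Sum>i<N. \<Sum>j<N. J i j * ((m i)\<^sup>2 / 2 + (m j)\<^sup>2 / 2))"
  proof (intro sum_mono mult_left_mono)
    show "m i * m j \<le> (m i)\<^sup>2 / 2 + (m j)\<^sup>2 / 2" for i j
      using sum_squares_bound[of "m i" "m j"] by simp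
  qed (use J in \<open>auto simp: coupling_matrix_def\<close>)
  also have "\<dots> = (\<Sum>i<N. \<Sum>j<N. J i j * (m i)\<^sup>2 / 2) + (\<Sum>i<N. \<Sum>j<N. J i j * (m j)\<^sup>2 / 2)"
    by (simp add: distrib_left sum.distrib)
  also have "(\<Sum>i<N. \<Sum>j<N. J i j * (m j)\<^sup>2 / 2) = (\<Sum>i<N. \<Sum>j<N. J i j * (m i)\<^sup>2 / 2)"
    using J by (subst sum.swap) (intro sum.cong refl, simp add: coupling_matrix_def)
  also have "(\<Sum>i<N. \<Sum>j<N. J i j * (m i)\<^sup>2 / 2) + (\<Sum>i<N. \<Sum>j<N. J i j * (m i)\<^sup>2 / 2) =
      (\<Sum>i<N. row_sum N J i * (m i)\<^sup>2)"
    by (simp add: row_sum_def sum_distrib_right flip: sum.distrib)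
  also have "\<dots> \<le> (\<Sum>i<N. (1 - \<delta>) * (m i)\<^sup>2)"
    using row by (intro sum_mono mult_right_mono) auto
  also have "\<dots> = ?M - \<delta> * ?M"
    by (simp add: left_diff_distrib sum_distrib_left sum_subtractf)
  finally have M: "\<delta> * ?M \<le> (\<Sum>i<N. h i * m i)" by simp
  \<comment> \<open>Young's inequality, weighted so that its \<delta> |m|^2 / 2 is at most half of
    the left side, by \<open>M\<close>.\<close>
  have "(\<Sum>i<N. h i * m i) \<le> (\<Sum>i<N. (\<delta> * (m i)\<^sup>2 + (h i)\<^sup>2 / \<delta>) / 2)"
  proof (rule sum_mono)
    fix i
    have "0 \<le> (\<delta> * m i - h i)\<^sup>2 / \<delta>" using \<delta> by simp
    also have "\<dots> = \<delta> * (m i)\<^sup>2 - 2 * (h i * m i) + (h i)\<^sup>2 / \<delta>"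
      using \<delta> by (simp add: power2_eq_square field_simps)
    finally show "h i * m i \<le> (\<delta> * (m i)\<^sup>2 + (h i)\<^sup>2 / \<delta>) / 2" by simp
  qed
  also have "\<dots> = (\<delta> * ?M + (\<Sum>i<N. (h i)\<^sup>2) / \<delta>) / 2"
    unfolding sum_distrib_left sum_divide_distrib sum.distrib[symmetric] ..
  finally have half: "(\<Sum>i<N. h i * m i) \<le> (\<delta> * ?M + (\<Sum>i<N. (h i)\<^sup>2) / \<delta>) / 2" .
  have "a \<le> c" if "a \<le> (b + c) / 2" "b \<le> a" for a b c :: real
    using that by simp
  from this[OF half M] show ?thesis .
qed

lemma sum_gibbs_pos: "0 < (\<Sum>\<sigma>\<in>spin_configs N. gibbs N J h \<sigma>)"
  by (rule sum_pos[OF finite_spin_configs])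
    (simp_all add: gibbs_def spin_configs_def PiE_eq_empty_iff)

text \<open>After normalization, Griffiths' first inequality makes the magnetizations
  \<open>m\<close> nonnegative, and \<open>mean_spin_le\<close> makes them satisfy the mean-field
  inequality.\<close>

lemma gibbs_linear_le:
  assumes J: "coupling_matrix N J" and \<delta>: "0 < \<delta>"
    and row: "\<And>i. i < N \<Longrightarrow> row_sum N J i \<le> 1 - \<delta>"
    and h: "\<And>i. i < N \<Longrightarrow> 0 \<le> h i"
  shows "(\<Sum>\<sigma>\<in>spin_configs N. gibbs N J h \<sigma> * (\<Sum>i<N. h i * \<sigma> i)) \<le>
    (\<Sum>i<N. (h i)\<^sup>2) / \<delta> * (\<Sum>\<sigma>\<in>spin_configs N. gibbs N J h \<sigma>)"
proof -
  define Z where "Z = (\<Sum>\<sigma>\<in>spin_configs N. gibbs N J h \<sigma>)"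
  define m where "m i = (\<Sum>\<sigma>\<in>spin_configs N. gibbs N J h \<sigma> * \<sigma> i) / Z" for i
  have Z: "0 < Z" unfolding Z_def by (rule sum_gibbs_pos)
  have "(\<Sum>i<N. h i * m i) \<le> (\<Sum>i<N. (h i)\<^sup>2) / \<delta>"
  proof (rule linear_bound_from_mean_field[OF J \<delta> row])
    fix i assume i: "i < N"
    show "0 \<le> m i"
      unfolding m_def using J h i Z
      by (intro divide_nonneg_pos pos_mult_sum_nonneg pos_mult_mult pos_mult_gibbs pos_mult_spin)
    have "m i \<le> (\<Sum>\<sigma>\<in>spin_configs N. gibbs N J h \<sigma> * ((\<Sum>j<N. J i j * \<sigma> j) + h i)) / Z"
      unfolding m_def using Z by (intro divide_right_mono mean_spin_le J h i) auto
    also have "(\<Sum>\<sigma>\<in>spin_configs N. gibbs N J h \<sigma> * ((\<Sum>j<N. J i j * \<sigma> j) + h i)) =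
        (\<Sum>j<N. J i j * (\<Sum>\<sigma>\<in>spin_configs N. gibbs N J h \<sigma> * \<sigma> j)) + h i * Z"
      unfolding Z_def distrib_left sum.distrib sum_distrib_left
      by (subst sum.swap) (simp add: mult_ac)
    also have "\<dots> / Z = (\<Sum>j<N. J i j * m j) + h i"
      using Z by (simp add: m_def add_divide_distrib sum_divide_distrib[of _ "{..<N}"])
    finally show "m i \<le> (\<Sum>j<N. J i j * m j) + h i" .
  qed
  then have "(\<Sum>i<N. h i * m i) * Z \<le> (\<Sum>i<N. (h i)\<^sup>2) / \<delta> * Z"
    using Z by (intro mult_right_mono) auto
  also have "(\<Sum>i<N. h i * m i) * Z =
      (\<Sum>i<N. h i * (\<Sum>\<sigma>\<in>spin_configs N. gibbs N J h \<sigma> * \<sigma> i))"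
    using Z by (simp add: m_def sum_distrib_right)
  also have "\<dots> = (\<Sum>\<sigma>\<in>spin_configs N. gibbs N J h \<sigma> * (\<Sum>i<N. h i * \<sigma> i))"
    unfolding sum_distrib_left by (subst sum.swap) (simp add: mult_ac)
  finally show ?thesis unfolding Z_def .
qed

text \<open>Damped by a Gaussian factor, the partition function at field \<open>t * h\<close> does
  not increase in \<open>t\<close>; comparing t = 1 with t = 0 gives the bound.\<close>

lemma gibbs_mgf:
  assumes J: "coupling_matrix N J" and \<delta>: "0 < \<delta>"
    and row: "\<And>i. i < N \<Longrightarrow> row_sum N J i \<le> 1 - \<delta>"
    and h: "\<And>i. i < N \<Longrightarrow> 0 \<le> h i"
  shows "(\<Sum>\<sigma>\<in>spin_configs N. gibbs N J h \<sigma>) \<le>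
    exp ((\<Sum>i<N. (h i)\<^sup>2) / (2 * \<delta>)) * (\<Sum>\<sigma>\<in>spin_configs N. gibbs N J (\<lambda>_. 0) \<sigma>)"
proof -
  define K where "K = (\<Sum>i<N. (h i)\<^sup>2) / \<delta>"
  define Z where "Z t = (\<Sum>\<sigma>\<in>spin_configs N. gibbs N J (\<lambda>i. t * h i) \<sigma>)" for t
  define Z' where "Z' t = (\<Sum>\<sigma>\<in>spin_configs N. gibbs N J (\<lambda>i. t * h i) \<sigma> * (\<Sum>i<N. h i * \<sigma> i))" for t
  define \<phi> where "\<phi> t = Z t * exp (- K * t\<^sup>2 / 2)" for t
  have gibbs_deriv: "((\<lambda>t. gibbs N J (\<lambda>i. t * h i) \<sigma>) has_real_derivative
      gibbs N J (\<lambda>i. t * h i) \<sigma> * (\<Sum>i<N. h i * \<sigma> i)) (at t)" for \<sigma> t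
  proof -
    have eq: "gibbs N J (\<lambda>i. t * h i) \<sigma> =
        exp ((\<Sum>i<N. \<Sum>j<N. \<sigma> i * J i j * \<sigma> j) / 2 + t * (\<Sum>i<N. h i * \<sigma> i))" for t
      by (simp add: gibbs_def sum_distrib_left mult_ac)
    show ?thesis unfolding eq by (auto intro!: derivative_eq_intros)
  qed
  have \<phi>_deriv: "(\<phi> has_real_derivative (Z' t - K * t * Z t) * exp (- K * t\<^sup>2 / 2)) (at t)" for t
    unfolding \<phi>_def[abs_def] Z_def Z'_def
    by (rule derivative_eq_intros gibbs_deriv refl | simp)+ (simp add: algebra_simps)
  have "\<phi> 1 \<le> \<phi> 0"
  proof (rule DERIV_nonpos_imp_decreasing_open[where f = \<phi>])
    fix t :: real assume t: "0 < t" and "t < 1"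
    \<comment> \<open>\<open>gibbs_linear_le\<close> at the field \<open>t * h\<close> bounds
      \<open>t\<close> times the derivative \<open>Z' t\<close>; dividing by \<open>t\<close>
      requires the open interval.\<close>
    have "t * Z' t \<le> t * (K * t * Z t)"
      using gibbs_linear_le[OF J \<delta> row, of "\<lambda>i. t * h i"] h t
      by (simp add: Z_def Z'_def K_def power_mult_distrib power2_eq_square mult_ac
          flip: sum_distrib_left)
    then have "Z' t \<le> K * t * Z t" using t by simp
    then have "(Z' t - K * t * Z t) * exp (- K * t\<^sup>2 / 2) \<le> 0"
      by (simp add: mult_nonpos_nonneg)
    then show "\<exists>y. (\<phi> has_real_derivative y) (at t) \<and> y \<le> 0"
      using \<phi>_deriv by blast
  next
    show "continuous_on {0..1} \<phi>"
      using \<phi>_deriv by (meson DERIV_isCont continuous_at_imp_continuous_on)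
  qed simp
  then have "Z 1 \<le> exp (K / 2) * Z 0"
    by (simp add: \<phi>_def exp_minus field_simps)
  then show ?thesis by (simp add: Z_def K_def mult.commute[of 2])
qed

text \<open>Flipping all spins preserves the quadratic part and reverses the field term. The
  restricted lambda keeps the value \<open>undefined\<close> off the sites.\<close>

lemma sum_gibbs_uminus:
  "(\<Sum>\<sigma>\<in>spin_configs N. gibbs N J (\<lambda>i. - h i) \<sigma>) = (\<Sum>\<sigma>\<in>spin_configs N. gibbs N J h \<sigma>)"
proof (rule sum.reindex_bij_witness[where i = "\<lambda>\<sigma>. \<lambda>i\<in>{..<N}. - \<sigma> i"
      and j = "\<lambda>\<sigma>. \<lambda>i\<in>{..<N}. - \<sigma> i"])
  fix \<sigma> assume \<sigma>: "\<sigma> \<in> spin_configs N"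
  then have ext: "\<sigma> i = undefined" if "\<not> i < N" for i
    using that by (auto simp: spin_configs_def PiE_iff extensional_def)
  show "(\<lambda>i\<in>{..<N}. - (\<lambda>i\<in>{..<N}. - \<sigma> i) i) = \<sigma>"
    by (auto simp: fun_eq_iff restrict_def ext)
  show "(\<lambda>i\<in>{..<N}. - (\<lambda>i\<in>{..<N}. - \<sigma> i) i) = \<sigma>"
    by (auto simp: fun_eq_iff restrict_def ext)
  show "(\<lambda>i\<in>{..<N}. - \<sigma> i) \<in> spin_configs N" "(\<lambda>i\<in>{..<N}. - \<sigma> i) \<in> spin_configs N"
    using \<sigma> by (auto simp: spin_configs_def PiE_iff)
  show "gibbs N J h (\<lambda>i\<in>{..<N}. - \<sigma> i) = gibbs N J (\<lambda>i. - h i) \<sigma>"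
    by (simp add: gibbs_def)
qed

section \<open>Transfer to the Ising measure\<close>

lemma ising_weight_conv_gibbs:
  "ising_weight N A \<beta> 0 = gibbs N (\<lambda>i j. \<beta> * A i j) (\<lambda>_. 0)"
  by (simp add: fun_eq_iff ising_weight_def gibbs_def sum_distrib_left sum_divide_distrib mult_ac)

lemma finite_set_pmf_ising: "finite (set_pmf (ising N A \<beta> B))"
  by (rule finite_subset[OF _ finite_spin_configs[of N]]) (auto simp: set_pmf_iff pmf_ising split: if_splits)

lemma integrable_ising: "integrable (measure_pmf (ising N A \<beta> B)) (f :: _ \<Rightarrow> real)"
  by (rule integrable_measure_pmf_finite[OF finite_set_pmf_ising])

lemma expectation_ising:
  "measure_pmf.expectation (ising N A \<beta> B) f =
    (\<Sum>\<sigma>\<in>spin_configs N. ising_weight N A \<beta> B \<sigma> * f \<sigma>) / partition_function N A \<beta> B"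
proof -
  have "measure_pmf.expectation (ising N A \<beta> B) f =
      (\<Sum>\<sigma>\<in>spin_configs N. f \<sigma> * pmf (ising N A \<beta> B) \<sigma>)"
    by (rule integral_measure_pmf_real[OF finite_spin_configs])
      (auto simp: set_pmf_iff pmf_ising split: if_splits)
  then show ?thesis by (simp add: pmf_ising sum_divide_distrib mult_ac)
qed

lemma coupling_matrix_scale:
  "coupling_matrix N A \<Longrightarrow> 0 \<le> \<beta> \<Longrightarrow> coupling_matrix N (\<lambda>i j. \<beta> * A i j)"
  by (simp add: coupling_matrix_def)

section \<open>Moment and tail bounds at high temperature\<close>

text \<open>The model at one fixed \<open>N\<close>. All bounds depend on the gap
  \<open>\<delta>\<close> only, so a gap common to all large \<open>N\<close> yields constants free
  of \<open>N\<close>.\<close>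

locale high_temperature =
  fixes N :: nat and A :: "nat \<Rightarrow> nat \<Rightarrow> real" and \<beta> \<delta> :: real
  assumes coupling: "coupling_matrix N A" and \<beta>_nonneg: "0 \<le> \<beta>" and \<delta>_pos: "0 < \<delta>"
    and row: "\<And>i. i < N \<Longrightarrow> \<beta> * row_sum N A i \<le> 1 - \<delta>"
begin

abbreviation E :: "((nat \<Rightarrow> real) \<Rightarrow> real) \<Rightarrow> real" where
  "E \<equiv> measure_pmf.expectation (ising N A \<beta> 0)"

lemma mgf_le:
  assumes h: "\<And>i. i < N \<Longrightarrow> 0 \<le> h i"
  shows "E (\<lambda>\<sigma>. exp (s * (\<Sum>i<N. h i * \<sigma> i))) \<le> exp (s\<^sup>2 * (\<Sum>i<N. (h i)\<^sup>2) / (2 * \<delta>))"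
proof -
  define J where "J = (\<lambda>i j. \<beta> * A i j)"
  have J: "coupling_matrix N J"
    unfolding J_def using coupling \<beta>_nonneg by (rule coupling_matrix_scale)
  have row: "row_sum N J i \<le> 1 - \<delta>" if "i < N" for i
    using row[OF that] by (simp add: J_def row_sum_def sum_distrib_left)
  have "E (\<lambda>\<sigma>. exp (s * (\<Sum>i<N. h i * \<sigma> i))) * partition_function N A \<beta> 0 =
      (\<Sum>\<sigma>\<in>spin_configs N. gibbs N J (\<lambda>_. 0) \<sigma> * exp (s * (\<Sum>i<N. h i * \<sigma> i)))"
    using partition_function_pos[of N A \<beta> 0]
    by (simp add: expectation_ising ising_weight_conv_gibbs J_def)
  also have "\<dots> = (\<Sum>\<sigma>\<in>spin_configs N. gibbs N J (\<lambda>i. s * h i) \<sigma>)"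
    by (simp add: gibbs_def sum_distrib_left mult.assoc flip: exp_add)
  \<comment> \<open>The global spin flip makes the field nonnegative for negative \<open>s\<close>
    too.\<close>
  also have "\<dots> = (\<Sum>\<sigma>\<in>spin_configs N. gibbs N J (\<lambda>i. \<bar>s\<bar> * h i) \<sigma>)"
    using sum_gibbs_uminus[of N J "\<lambda>i. s * h i"] by (cases "s \<ge> 0") auto
  also have "\<dots> \<le> exp ((\<Sum>i<N. (\<bar>s\<bar> * h i)\<^sup>2) / (2 * \<delta>)) *
      (\<Sum>\<sigma>\<in>spin_configs N. gibbs N J (\<lambda>_. 0) \<sigma>)"
    using h by (intro gibbs_mgf J \<delta>_pos row) auto
  also have "(\<Sum>i<N. (\<bar>s\<bar> * h i)\<^sup>2) = s\<^sup>2 * (\<Sum>i<N. (h i)\<^sup>2)"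
    by (simp add: power_mult_distrib sum_distrib_left)
  also have "(\<Sum>\<sigma>\<in>spin_configs N. gibbs N J (\<lambda>_. 0) \<sigma>) = partition_function N A \<beta> 0"
    by (simp add: partition_function_def ising_weight_conv_gibbs J_def)
  finally show ?thesis using partition_function_pos[of N A \<beta> 0] by simp
qed

lemma expectation_spin_pair_nonneg:
  assumes "i < N" "j < N" shows "0 \<le> E (\<lambda>\<sigma>. \<sigma> i * \<sigma> j)"
  unfolding expectation_ising ising_weight_conv_gibbs using assms coupling \<beta>_nonneg
  by (intro divide_nonneg_pos partition_function_pos pos_mult_sum_nonneg pos_mult_mult
      pos_mult_gibbs pos_mult_spin coupling_matrix_scale) auto

text \<open>Expanding the square leaves pair correlations, which are nonnegative. This passes from
  signed coefficients to their absolute values, to which \<open>mgf_le\<close> applies.\<close>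

lemma second_moment_mono:
  assumes "\<And>i. i < N \<Longrightarrow> \<bar>c i\<bar> \<le> d i"
  shows "E (\<lambda>\<sigma>. (\<Sum>i<N. c i * \<sigma> i)\<^sup>2) \<le> E (\<lambda>\<sigma>. (\<Sum>i<N. d i * \<sigma> i)\<^sup>2)"
proof -
  have expand: "E (\<lambda>\<sigma>. (\<Sum>i<N. c i * \<sigma> i)\<^sup>2) = (\<Sum>i<N. \<Sum>j<N. c i * c j * E (\<lambda>\<sigma>. \<sigma> i * \<sigma> j))"
    for c
  proof -
    have "(\<lambda>\<sigma>. (\<Sum>i<N. c i * \<sigma> i)\<^sup>2) = (\<lambda>\<sigma>. \<Sum>i<N. \<Sum>j<N. c i * c j * (\<sigma> i * \<sigma> j))"
      by (simp add: power2_eq_square sum_product mult_ac)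
    then show ?thesis by (simp add: integrable_ising)
  qed
  have "c i * c j \<le> d i * d j" if "i < N" "j < N" for i j
  proof -
    have "c i * c j \<le> \<bar>c i\<bar> * \<bar>c j\<bar>" using abs_ge_self[of "c i * c j"] by (simp add: abs_mult)
    also have "\<dots> \<le> d i * d j"
      using assms[OF that(1)] assms[OF that(2)] by (intro mult_mono) auto
    finally show ?thesis .
  qed
  then show ?thesis
    unfolding expand
    by (intro sum_mono mult_right_mono expectation_spin_pair_nonneg) auto
qed

lemma second_moment_le:
  "E (\<lambda>\<sigma>. (\<Sum>i<N. c i * \<sigma> i)\<^sup>2) \<le> 4 * exp (1 / (2 * \<delta>)) * (\<Sum>i<N. (c i)\<^sup>2)"
proof (cases "(\<Sum>i<N. (c i)\<^sup>2) = 0")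
  case True
  then have "c i = 0" if "i < N" for i
    using that by (simp add: sum_nonneg_eq_0_iff)
  then show ?thesis by simp
next
  case False
  define S where "S = (\<Sum>i<N. (c i)\<^sup>2)"
  \<comment> \<open>This scale turns the exponent in \<open>mgf_le\<close> into 1 / (2
    \<delta>).\<close>
  define s where "s = 1 / sqrt S"
  define X where "X = (\<lambda>\<sigma>. \<Sum>i<N. \<bar>c i\<bar> * \<sigma> i)"
  have S: "0 < S" using False sum_nonneg[of "{..<N}" "\<lambda>i. (c i)\<^sup>2"] by (simp add: S_def)
  have sS: "s\<^sup>2 * S = 1" using S by (simp add: s_def power_divide)
  have square_le: "y\<^sup>2 \<le> 2 * (exp y + exp (- y))" for y :: real
  proof -
    have "\<bar>y\<bar>\<^sup>2 / 2 \<le> exp \<bar>y\<bar>"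
      using exp_lower_Taylor_quadratic[of "\<bar>y\<bar>"] by linarith
    also have "\<dots> \<le> exp y + exp (- y)" by (cases "0 \<le> y") auto
    finally show ?thesis by simp
  qed
  have "s\<^sup>2 * E (\<lambda>\<sigma>. (\<Sum>i<N. c i * \<sigma> i)\<^sup>2) \<le> s\<^sup>2 * E (\<lambda>\<sigma>. (X \<sigma>)\<^sup>2)"
    unfolding X_def by (intro mult_left_mono second_moment_mono) auto
  also have "\<dots> = E (\<lambda>\<sigma>. (s * X \<sigma>)\<^sup>2)"
    by (simp add: power_mult_distrib)
  also have "\<dots> \<le> E (\<lambda>\<sigma>. 2 * (exp (s * X \<sigma>) + exp (- s * X \<sigma>)))"
    using square_le by (intro integral_mono integrable_ising) simp
  also have "\<dots> = 2 * (E (\<lambda>\<sigma>. exp (s * X \<sigma>)) + E (\<lambda>\<sigma>. exp (- s * X \<sigma>)))"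
    by (simp add: integrable_ising)
  also have "\<dots> \<le> 2 * (exp (1 / (2 * \<delta>)) + exp (1 / (2 * \<delta>)))"
    using mgf_le[of "\<lambda>i. \<bar>c i\<bar>" s] mgf_le[of "\<lambda>i. \<bar>c i\<bar>" "- s"] sS
    by (simp add: X_def S_def)
  finally have "S * (s\<^sup>2 * E (\<lambda>\<sigma>. (\<Sum>i<N. c i * \<sigma> i)\<^sup>2)) \<le> S * (4 * exp (1 / (2 * \<delta>)))"
    using S by (intro mult_left_mono) auto
  moreover have "S * (s\<^sup>2 * e) = e" for e
    using sS by (metis mult.assoc mult.commute mult_1)
  ultimately have "E (\<lambda>\<sigma>. (\<Sum>i<N. c i * \<sigma> i)\<^sup>2) \<le> S * (4 * exp (1 / (2 * \<delta>)))"
    by metis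
  then show ?thesis unfolding S_def by (simp only: mult.commute)
qed

text \<open>Chernoff's bound for each site and each sign, then a union bound; hence the prefactor
  2N.\<close>

lemma local_field_tail:
  assumes N: "0 < N" and alpha: "0 < alpha N A" and u: "0 \<le> u"
  shows "measure_pmf.prob (ising N A \<beta> 0) {\<sigma>. u \<le> (MAX i\<in>{..<N}. \<bar>local_field N A i \<sigma>\<bar>)} \<le>
    2 * real N * exp (- \<delta> * u\<^sup>2 / (2 * alpha N A))"
proof -
  \<comment> \<open>The minimizer of s^2 \<alpha> / (2 \<delta>) - s u, with \<alpha> =
    \<open>alpha N A\<close>.\<close>
  define s where "s = \<delta> * u / alpha N A"
  have s: "0 \<le> s" using u alpha \<delta>_pos by (simp add: s_def)
  let ?X = "local_field N A"
  let ?S = "{\<sigma>. u \<le> (MAX i\<in>{..<N}. \<bar>?X i \<sigma>\<bar>)}"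
  have mgf: "E (\<lambda>\<sigma>. exp (t * ?X i \<sigma>)) \<le> exp (t\<^sup>2 * alpha N A / (2 * \<delta>))" if i: "i < N" for t i
  proof -
    have "E (\<lambda>\<sigma>. exp (t * ?X i \<sigma>)) \<le> exp (t\<^sup>2 * (\<Sum>j<N. (A i j)\<^sup>2) / (2 * \<delta>))"
      unfolding local_field_def using coupling i by (intro mgf_le) (simp add: coupling_matrix_def)
    also have "(\<Sum>j<N. (A i j)\<^sup>2) \<le> alpha N A"
      unfolding alpha_def using i by (intro Max_ge) auto
    finally show ?thesis using \<delta>_pos by (simp add: mult_left_mono divide_right_mono)
  qed
  have indicator: "indicator ?S \<sigma> \<le>
      (\<Sum>i<N. exp (- s * u) * (exp (s * ?X i \<sigma>) + exp (- s * ?X i \<sigma>)))" for \<sigma>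
  proof (cases "\<sigma> \<in> ?S")
    case True
    then obtain i where i: "i < N" "u \<le> \<bar>?X i \<sigma>\<bar>"
      using N by (auto simp: Max_ge_iff lessThan_empty_iff)
    have "1 \<le> exp (- s * u) * exp (s * \<bar>?X i \<sigma>\<bar>)"
      using mult_left_mono[OF i(2) s] by (simp flip: exp_add)
    also have "\<dots> \<le> exp (- s * u) * (exp (s * ?X i \<sigma>) + exp (- s * ?X i \<sigma>))"
      by (intro mult_left_mono) (auto simp: abs_if)
    also have "\<dots> \<le> (\<Sum>i<N. exp (- s * u) * (exp (s * ?X i \<sigma>) + exp (- s * ?X i \<sigma>)))"
      using i(1) by (intro member_le_sum) auto
    finally show ?thesis using True by simp
  qed (auto intro!: sum_nonneg)
  have "measure_pmf.prob (ising N A \<beta> 0) ?S = E (indicator ?S)" by simp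
  also have "\<dots> \<le> E (\<lambda>\<sigma>. \<Sum>i<N. exp (- s * u) * (exp (s * ?X i \<sigma>) + exp (- s * ?X i \<sigma>)))"
    using indicator by (intro integral_mono integrable_ising)
  also have "\<dots> = (\<Sum>i<N. exp (- s * u) * (E (\<lambda>\<sigma>. exp (s * ?X i \<sigma>)) + E (\<lambda>\<sigma>. exp (- s * ?X i \<sigma>))))"
    by (simp add: integrable_ising)
  also have "\<dots> \<le> (\<Sum>i<N. exp (- s * u) *
      (exp (s\<^sup>2 * alpha N A / (2 * \<delta>)) + exp (s\<^sup>2 * alpha N A / (2 * \<delta>))))"
    using mgf[of _ s] mgf[of _ "- s"] by (intro sum_mono mult_left_mono add_mono) auto
  also have "\<dots> = 2 * real N * exp (s\<^sup>2 * alpha N A / (2 * \<delta>) - s * u)"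
  proof -
    have "exp (- s * u) * (exp a + exp a) = 2 * exp (a - s * u)" for a
      by (simp add: distrib_left flip: exp_add)
    then show ?thesis by simp
  qed
  also have "s\<^sup>2 * alpha N A / (2 * \<delta>) - s * u = - \<delta> * u\<^sup>2 / (2 * alpha N A)"
    using alpha \<delta>_pos by (simp add: s_def power2_eq_square field_simps)
  finally show ?thesis .
qed

text \<open>The Chernoff exponent is 2 q log N with q = \<delta> lam^2 / 4. The prefactor 2N costs
  at most 2 log N, and the lower bound on \<open>lam\<close> makes q \<ge> 2, so that it is
  absorbed.\<close>

lemma local_field_log_tail:
  assumes N: "3 \<le> N" and alpha: "0 < alpha N A" and lam: "sqrt (8 / \<delta>) \<le> lam"
  shows "log_prob (measure_pmf.prob (ising N A \<beta> 0)
      {\<sigma>. lam * sqrt (alpha N A * ln (real N)) \<le> (MAX i\<in>{..<N}. \<bar>local_field N A i \<sigma>\<bar>)})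
    \<le> ereal (- (\<delta> / 4) * lam\<^sup>2)"
    (is "log_prob ?p \<le> _")
proof -
  have lnN: "1 \<le> ln (real N)"
    using N exp_le by (simp add: ln_ge_iff)
  have "0 \<le> sqrt (8 / \<delta>)" using \<delta>_pos by simp
  then have lam0: "0 \<le> lam" using lam by linarith
  have "8 / \<delta> \<le> lam\<^sup>2"
    using lam lam0 by (simp add: real_sqrt_le_iff' real_le_lsqrt sqrt_le_D)
  then have lam2: "2 \<le> \<delta> / 4 * lam\<^sup>2"
    using \<delta>_pos by (simp add: field_simps)
  have "?p \<le> 2 * real N * exp (- \<delta> * (lam * sqrt (alpha N A * ln (real N)))\<^sup>2 / (2 * alpha N A))"
    using N alpha lam0 lnN by (intro local_field_tail) auto
  also have "- \<delta> * (lam * sqrt (alpha N A * ln (real N)))\<^sup>2 / (2 * alpha N A) =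
      - 2 * (\<delta> / 4 * lam\<^sup>2) * ln (real N)"
    using alpha lnN by (simp add: power_mult_distrib)
  also have "2 * real N \<le> exp (2 * ln (real N))"
    using N by (simp add: exp_double power2_eq_square)
  also have "exp (2 * ln (real N)) * exp (- 2 * (\<delta> / 4 * lam\<^sup>2) * ln (real N)) =
      exp (- (2 * (\<delta> / 4 * lam\<^sup>2) - 2) * ln (real N))"
    by (simp add: algebra_simps flip: exp_add)
  also have "\<dots> \<le> exp (- (\<delta> / 4 * lam\<^sup>2))"
  proof -
    \<comment> \<open>Here q \<ge> 2 gives q \<le> 2 q - 2, and N \<ge> 3 > e gives log N \<ge>
      1.\<close>
    have "(\<delta> / 4 * lam\<^sup>2) * 1 \<le> (2 * (\<delta> / 4 * lam\<^sup>2) - 2) * ln (real N)"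
      using lam2 lnN by (intro mult_mono) auto
    then show ?thesis unfolding exp_le_cancel_iff by linarith
  qed
  finally have p: "?p \<le> exp (- (\<delta> / 4) * lam\<^sup>2)" by simp
  show ?thesis
  proof (cases "?p = 0")
    case False
    then have "0 < ?p" by (simp add: zero_less_measure_iff)
    then have "ln ?p \<le> - (\<delta> / 4) * lam\<^sup>2"
      using p by (metis ln_exp ln_le_cancel_iff exp_gt_zero)
    then show ?thesis by (simp add: log_prob_def)
  qed (simp add: log_prob_def)
qed

end

section \<open>Assembly along the sequence of models\<close>

text \<open>This handles the finitely many \<open>N\<close> for which high temperature may fail.\<close>

lemma second_moment_le_card:
  "measure_pmf.expectation (ising N A \<beta> B) (\<lambda>\<sigma>. (\<Sum>i<N. c i * \<sigma> i)\<^sup>2) \<le> real N * (\<Sum>i<N. (c i)\<^sup>2)"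
proof (rule measure_pmf.integral_le_const[OF integrable_ising])
  show "AE \<sigma> in measure_pmf (ising N A \<beta> B).
      (\<Sum>i<N. c i * \<sigma> i)\<^sup>2 \<le> real N * (\<Sum>i<N. (c i)\<^sup>2)"
  proof (rule AE_pmfI)
    fix \<sigma> assume "\<sigma> \<in> set_pmf (ising N A \<beta> B)"
    then have \<sigma>: "\<sigma> \<in> spin_configs N" by (auto simp: set_pmf_iff pmf_ising split: if_splits)
    have "(\<sigma> i)\<^sup>2 = 1" if "i < N" for i
      using spin_square[OF \<sigma> that] by auto
    then show "(\<Sum>i<N. c i * \<sigma> i)\<^sup>2 \<le> real N * (\<Sum>i<N. (c i)\<^sup>2)"
      using Cauchy_Schwarz_ineq_sum[of c \<sigma> "{..<N}"] by (simp add: mult.commute)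
  qed
qed

text \<open>The Chernoff bound divides by \<open>alpha\<close>; a positive row sum forces a nonzero
  entry.\<close>

lemma alpha_pos:
  assumes "i < N" "0 < row_sum N A i" shows "0 < alpha N A"
proof -
  obtain j where j: "j < N" "A i j \<noteq> 0"
    using assms(2) unfolding row_sum_def by (metis lessThan_iff less_irrefl sum.neutral)
  have "0 < (A i j)\<^sup>2" using j by simp
  also have "\<dots> \<le> (\<Sum>j<N. (A i j)\<^sup>2)" using j by (intro member_le_sum) auto
  also have "\<dots> \<le> alpha N A" unfolding alpha_def using assms(1) by (intro Max_ge) auto
  finally show ?thesis .
qed

text \<open>In the first part \<open>C\<close> and \<open>lam0\<close> are fixed before
  \<open>N\<close> and \<open>lam\<close>; the threshold \<open>lam0\<close> is where the union
  bound's prefactor is absorbed.\<close>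

theorem lemma2p2:
  fixes A :: "nat \<Rightarrow> nat \<Rightarrow> nat \<Rightarrow> real" and \<beta> :: real
  assumes "0 < \<beta>" and "\<beta> < 1"
    and "\<And>N. coupling_matrix N (A N)"
    and "(\<lambda>N. MAX i\<in>{..<N}. row_sum N (A N) i) \<longlonglongrightarrow> 1"
  shows "(\<exists>C>0. \<exists>lam0>0. \<forall>\<^sub>F N in sequentially. \<forall>lam\<ge>lam0.
           log_prob (measure_pmf.prob (ising N (A N) \<beta> 0)
             {\<sigma>. (MAX i\<in>{..<N}. \<bar>local_field N (A N) i \<sigma>\<bar>)
                   \<ge> lam * sqrt (alpha N (A N) * ln (real N))})
           \<le> ereal (- C * lam\<^sup>2)) \<and>
         (\<exists>C>0. \<forall>N\<ge>1.
           measure_pmf.expectation (ising N (A N) \<beta> 0)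
             (\<lambda>\<sigma>. (\<Sum>i<N. (row_sum N (A N) i - 1) * \<sigma> i)\<^sup>2)
           \<le> C * ((\<Sum>i<N. (row_sum N (A N) i - 1)\<^sup>2)
                * (1 + (frobenius_norm N (A N))\<^sup>2 * (alpha N (A N))\<^sup>2 * (ln (real N))\<^sup>2)))"
proof (rule conjI)
  \<comment> \<open>Half the gap: 1 - \<delta> = (1 + \<beta>) / 2 still exceeds \<beta>, leaving
    room for row sums slightly above 1.\<close>
  define \<delta> where "\<delta> = (1 - \<beta>) / 2"
  define R where "R N = (MAX i\<in>{..<N}. row_sum N (A N) i)" for N
  have \<delta>: "0 < \<delta>" using assms(2) by (simp add: \<delta>_def)
  have R_lim: "R \<longlonglongrightarrow> 1" using assms(4) by (simp add: R_def[abs_def])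
  have "1 < (1 - \<delta>) / \<beta>" using assms(1,2) by (simp add: \<delta>_def field_simps)
  \<comment> \<open>The three conditions serve, in order, positivity of \<open>alpha\<close>, the
    high-temperature gap, and log N \<ge> 1.\<close>
  then have "\<forall>\<^sub>F N in sequentially. 0 < R N \<and> R N < (1 - \<delta>) / \<beta> \<and> 3 \<le> N"
    using order_tendstoD[OF R_lim] eventually_ge_at_top[of "3::nat"]
    by (simp add: eventually_conj)
  then obtain N0 where N0: "\<And>N. N0 \<le> N \<Longrightarrow> 0 < R N \<and> R N < (1 - \<delta>) / \<beta> \<and> 3 \<le> N"
    unfolding eventually_sequentially by blast
  have high: "high_temperature N (A N) \<beta> \<delta>" if "N0 \<le> N" for N
  proof
    fix i assume "i < N"
    then have "row_sum N (A N) i \<le> R N" unfolding R_def by (intro Max_ge) auto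
    then have "row_sum N (A N) i \<le> (1 - \<delta>) / \<beta>" using N0[OF that] by linarith
    then show "\<beta> * row_sum N (A N) i \<le> 1 - \<delta>" using assms(1) by (simp add: field_simps)
  qed (use assms(1,3) \<delta> in auto)
  have alpha: "0 < alpha N (A N)" if "N0 \<le> N" for N
  proof -
    have "R N \<in> row_sum N (A N) ` {..<N}"
      unfolding R_def using N0[OF that] by (intro Max_in) (auto simp: lessThan_empty_iff)
    then show ?thesis using N0[OF that] alpha_pos by fastforce
  qed
  show "\<exists>C>0. \<exists>lam0>0. \<forall>\<^sub>F N in sequentially. \<forall>lam\<ge>lam0.
           log_prob (measure_pmf.prob (ising N (A N) \<beta> 0)
             {\<sigma>. (MAX i\<in>{..<N}. \<bar>local_field N (A N) i \<sigma>\<bar>)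
                   \<ge> lam * sqrt (alpha N (A N) * ln (real N))})
           \<le> ereal (- C * lam\<^sup>2)"
  proof (intro exI conjI)
    show "\<forall>\<^sub>F N in sequentially. \<forall>lam\<ge>sqrt (8 / \<delta>).
           log_prob (measure_pmf.prob (ising N (A N) \<beta> 0)
             {\<sigma>. (MAX i\<in>{..<N}. \<bar>local_field N (A N) i \<sigma>\<bar>)
                   \<ge> lam * sqrt (alpha N (A N) * ln (real N))})
           \<le> ereal (- (\<delta> / 4) * lam\<^sup>2)"
      using eventually_ge_at_top[of N0]
    proof eventually_elim
      case (elim N)
      then show ?case
        using high_temperature.local_field_log_tail[OF high] N0 alpha by blast
    qed
  qed (use \<delta> in auto)
  \<comment> \<open>The first entry serves N \<ge> N0; below N0 the Cauchy-Schwarz factor N is at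
    most N0.\<close>
  define C where "C = max (4 * exp (1 / (2 * \<delta>))) (real N0)"
  have C: "0 < C" by (simp add: C_def less_max_iff_disj)
  show "\<exists>C>0. \<forall>N\<ge>1.
           measure_pmf.expectation (ising N (A N) \<beta> 0)
             (\<lambda>\<sigma>. (\<Sum>i<N. (row_sum N (A N) i - 1) * \<sigma> i)\<^sup>2)
           \<le> C * ((\<Sum>i<N. (row_sum N (A N) i - 1)\<^sup>2)
                * (1 + (frobenius_norm N (A N))\<^sup>2 * (alpha N (A N))\<^sup>2 * (ln (real N))\<^sup>2))"
  proof (intro exI[of _ C] conjI C allI impI)
    fix N :: nat
    let ?c = "\<lambda>i. row_sum N (A N) i - 1"
    have S: "0 \<le> (\<Sum>i<N. (?c i)\<^sup>2)" by (simp add: sum_nonneg)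
    have "measure_pmf.expectation (ising N (A N) \<beta> 0) (\<lambda>\<sigma>. (\<Sum>i<N. ?c i * \<sigma> i)\<^sup>2) \<le>
        (if N0 \<le> N then 4 * exp (1 / (2 * \<delta>)) else real N) * (\<Sum>i<N. (?c i)\<^sup>2)"
      using high_temperature.second_moment_le[OF high] second_moment_le_card by auto
    also have "\<dots> \<le> C * (\<Sum>i<N. (?c i)\<^sup>2)"
      using S by (intro mult_right_mono) (auto simp: C_def)
    \<comment> \<open>The bracket is at least 1.\<close>
    also have "\<dots> \<le> C * ((\<Sum>i<N. (?c i)\<^sup>2)
        * (1 + (frobenius_norm N (A N))\<^sup>2 * (alpha N (A N))\<^sup>2 * (ln (real N))\<^sup>2))"
      using C S mult_left_mono[of 1 _ "\<Sum>i<N. (?c i)\<^sup>2"] by (intro mult_left_mono) auto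
    finally show "measure_pmf.expectation (ising N (A N) \<beta> 0) (\<lambda>\<sigma>. (\<Sum>i<N. ?c i * \<sigma> i)\<^sup>2) \<le>
        C * ((\<Sum>i<N. (?c i)\<^sup>2)
        * (1 + (frobenius_norm N (A N))\<^sup>2 * (alpha N (A N))\<^sup>2 * (ln (real N))\<^sup>2))" .
  qed
qed

end
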